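(* Let $G$ be a finite connected simple graph with at least three vertices. If $G$ is a hairy graph, then $G$ is an SR-graph.
   Context: $\gamma(G)$ denotes the domination number of a finite simple graph $G$. For an edge $e=uv$ of $G$, $G-e$ is the graph obtained by deleting $e$, and $G_e$ is the graph obtained by subdividing $e$: delete $e$, add a new vertex $w$ and the edges $uw$ and $wv$. A finite connected simple graph $G$ of order at least two is an SR-graph (sub-removable graph) if $\gamma(G-e)=\gamma(G_e)$ for every edge $e$ of $G$. A leaf is a vertex of degree $1$; a support vertex is a vertex adjacent to a leaf. A graph is a hairy graph if each of its vertices is a leaf or a support vertex. *)

theory Defs
  imports "Graph_Theory.Digraph_Component"
begin

text \<open>
  Finite simple graphs are the \<^locale>\<open>pair_graph\<close>s of the AFP entry Graph\_Theory: finite,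
  loop-free, symmetric digraphs without parallel arcs. An edge \<open>uv\<close> is the pair of arcs
  \<open>(u,v)\<close>, \<open>(v,u)\<close>, so the degree of a vertex is its out-degree.
\<close>

definition dominating_set :: "'a pair_pre_digraph \<Rightarrow> 'a set \<Rightarrow> bool" where
  "dominating_set G D \<longleftrightarrow>
     D \<subseteq> pverts G \<and> (\<forall>v \<in> pverts G - D. \<exists>u \<in> D. u \<rightarrow>\<^bsub>with_proj G\<^esub> v)"

definition domination_number :: "'a pair_pre_digraph \<Rightarrow> nat" where
  "domination_number G = (LEAST k. \<exists>D. dominating_set G D \<and> card D = k)"

definition delete_edge :: "'a pair_pre_digraph \<Rightarrow> 'a \<times> 'a \<Rightarrow> 'a pair_pre_digraph" where
  "delete_edge G e = G\<lparr>parcs := parcs G - {e, prod.swap e}\<rparr>"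

text \<open>
  The vertices of \<open>G\<close> may exhaust the type \<open>'a\<close>. To have a new vertex available in every
  case, \<open>G\<close> is copied along \<^const>\<open>Some\<close> before subdividing, and \<^const>\<open>None\<close> is the vertex
  inserted into the edge.
\<close>

definition some_copy :: "'a pair_pre_digraph \<Rightarrow> 'a option pair_pre_digraph" where
  "some_copy G = \<lparr>pverts = Some ` pverts G, parcs = map_prod Some Some ` parcs G\<rparr>"

definition subdivide_edge :: "'a pair_pre_digraph \<Rightarrow> 'a \<times> 'a \<Rightarrow> 'a option pair_pre_digraph" where
  "subdivide_edge G e = subdivide (some_copy G) (map_prod Some Some e) None"

definition sr_graph :: "'a pair_pre_digraph \<Rightarrow> bool" where
  "sr_graph G \<longleftrightarrow>
     pair_graph G \<and> Digraph_Component.connected (with_proj G) \<and> 2 \<le> card (pverts G) \<and>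
     (\<forall>e \<in> parcs G. domination_number (delete_edge G e) = domination_number (subdivide_edge G e))"

definition leaf :: "'a pair_pre_digraph \<Rightarrow> 'a \<Rightarrow> bool" where
  "leaf G v \<longleftrightarrow> v \<in> pverts G \<and> out_degree (with_proj G) v = 1"

definition support_vertex :: "'a pair_pre_digraph \<Rightarrow> 'a \<Rightarrow> bool" where
  "support_vertex G v \<longleftrightarrow> v \<in> pverts G \<and> (\<exists>u. leaf G u \<and> v \<rightarrow>\<^bsub>with_proj G\<^esub> u)"

definition hairy_graph :: "'a pair_pre_digraph \<Rightarrow> bool" where
  "hairy_graph G \<longleftrightarrow> (\<forall>v \<in> pverts G. leaf G v \<or> support_vertex G v)"

end

theory Submission
  imports Defs
begin

text \<open>
  Equality of domination numbers is certified by exhibiting one dominating set \<open>D\<close> and one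
  packing \<open>P\<close> (vertices with pairwise disjoint closed neighbourhoods) of the same size which
  serve both \<open>G - e\<close> and \<open>G\<^sub>e\<close>. Let \<open>S\<close> be the set of support vertices and \<open>l x\<close> a leaf
  at \<open>x \<in> S\<close>. If \<open>e\<close> joins two support vertices, take \<open>D = S\<close> and \<open>P = l ` S\<close>. If \<open>e = uv\<close>
  with \<open>v\<close> a leaf and \<open>u\<close> has another leaf, choose \<open>l u \<noteq> v\<close> and take \<open>D = S \<union> {v}\<close>,
  \<open>P = l ` S \<union> {v}\<close>. If \<open>v\<close> is the only leaf at \<open>u\<close>, then \<open>u\<close> has a neighbour in \<open>S\<close>, and
  \<open>D = (S - {u}) \<union> {v}\<close>, \<open>P = l ` S\<close> works.
\<close>

section \<open>Packings as lower bounds for domination\<close>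

definition packing :: "'a pair_pre_digraph \<Rightarrow> 'a set \<Rightarrow> bool" where
  "packing H P \<longleftrightarrow> P \<subseteq> pverts H \<and>
     (\<forall>p\<in>P. \<forall>q\<in>P. \<forall>z. (z = p \<or> (z, p) \<in> parcs H) \<and> (z = q \<or> (z, q) \<in> parcs H) \<longrightarrow> p = q)"

text \<open>Each member of \<open>P\<close> has a member of \<open>D\<close> in its closed
  neighbourhood. Disjointness of these neighbourhoods makes any such choice \<open>f\<close>
  injective.\<close>

lemma packing_le_dominating:
  assumes fin: "finite (pverts H)" and D: "dominating_set H D" and P: "packing H P"
  shows "card P \<le> card D"
proof -
  have "\<exists>z\<in>D. z = p \<or> (z, p) \<in> parcs H" if "p \<in> P" for p
  proof (cases "p \<in> D")
    case False
    then have "p \<in> pverts H - D"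
      using that P by (auto simp: packing_def)
    then show ?thesis
      using D by (auto simp: dominating_set_def)
  qed blast
  then obtain f where f: "\<And>p. p \<in> P \<Longrightarrow> f p \<in> D \<and> (f p = p \<or> (f p, p) \<in> parcs H)"
    by metis
  have "inj_on f P"
    using f P unfolding inj_on_def packing_def by metis
  moreover have "f ` P \<subseteq> D"
    using f by blast
  moreover have "finite D"
    using D fin finite_subset unfolding dominating_set_def by blast
  ultimately show ?thesis
    by (rule card_inj_on_le)
qed

lemma domination_number_eqI:
  assumes "finite (pverts H)" "dominating_set H D" "packing H P" "card P = card D"
  shows "domination_number H = card D"
  unfolding domination_number_def
proof (rule Least_equality)
  show "\<exists>D'. dominating_set H D' \<and> card D' = card D"
    using assms(2) by blast
next
  fix k assume "\<exists>D'. dominating_set H D' \<and> card D' = k"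
  then show "card D \<le> k"
    using packing_le_dominating[OF assms(1) _ assms(3)] assms(4) by metis
qed

section \<open>Comparing edge deletion with edge subdivision\<close>

lemma pverts_subdivide_edge [simp]: "pverts (subdivide_edge G e) = insert None (Some ` pverts G)"
  by (cases e) (auto simp: subdivide_edge_def some_copy_def subdivide.simps)

text \<open>Phrased through \<open>delete_edge\<close> so that the subdivided graph appears as a
  copy of the edge-deleted one plus a path through \<open>None\<close>. This is what lets
  certificates transfer.\<close>

lemma parcs_subdivide_edge:
  "parcs (subdivide_edge G (u, v)) = map_prod Some Some ` parcs (delete_edge G (u, v)) \<union>
     {(Some u, None), (None, Some u), (None, Some v), (Some v, None)}"
  by (auto simp: subdivide_edge_def some_copy_def subdivide.simps delete_edge_def)

lemma delete_edge_commute: "delete_edge G (u, v) = delete_edge G (v, u)"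
  by (simp add: delete_edge_def insert_commute)

lemma subdivide_edge_commute: "subdivide_edge G (u, v) = subdivide_edge G (v, u)"
  by (simp add: subdivide_edge_def subdivide.simps insert_commute)

text \<open>Arcs between old vertices are the same in both graphs, so only \<open>None\<close> needs
  care: \<open>uv\<close> makes \<open>D\<close> dominate it, and \<open>not_both\<close> keeps it
  from lying in two closed neighbourhoods of the packing.\<close>

lemma domination_number_delete_eq_subdivide:
  assumes fin: "finite (pverts G)"
    and D: "dominating_set (delete_edge G (u, v)) D" and uv: "u \<in> D \<or> v \<in> D"
    and P: "packing (delete_edge G (u, v)) P" and not_both: "u \<notin> P \<or> v \<notin> P"
    and card: "card P = card D"
  shows "domination_number (delete_edge G (u, v)) = domination_number (subdivide_edge G (u, v))"
proof -
  have "domination_number (delete_edge G (u, v)) = card D"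
    using card by (intro domination_number_eqI[OF _ D P]) (simp_all add: fin delete_edge_def)
  moreover have "domination_number (subdivide_edge G (u, v)) = card (Some ` D)"
  proof (rule domination_number_eqI)
    show "finite (pverts (subdivide_edge G (u, v)))"
      using fin by simp
    show "dominating_set (subdivide_edge G (u, v)) (Some ` D)"
      using D uv unfolding dominating_set_def
      by (fastforce simp: parcs_subdivide_edge delete_edge_def)
    show "packing (subdivide_edge G (u, v)) (Some ` P)"
      unfolding packing_def
    proof (intro conjI ballI allI impI)
      show "Some ` P \<subseteq> pverts (subdivide_edge G (u, v))"
        using P by (auto simp: packing_def delete_edge_def)
      fix p' q' z
      assume "p' \<in> Some ` P" "q' \<in> Some ` P"
        and z: "(z = p' \<or> (z, p') \<in> parcs (subdivide_edge G (u, v))) \<and>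
                (z = q' \<or> (z, q') \<in> parcs (subdivide_edge G (u, v)))"
      then obtain p q where pq: "p' = Some p" "q' = Some q" "p \<in> P" "q \<in> P"
        by blast
      show "p' = q'"
      proof (cases z)
        \<comment> \<open>The neighbours of \<open>None\<close> are just the copies of
          \<open>u\<close> and \<open>v\<close>, so a clash here would put both into
          \<open>P\<close>.\<close>
        case None
        then show ?thesis
          using z pq not_both by (auto simp: parcs_subdivide_edge)
      next
        case (Some y)
        then have "(y = p \<or> (y, p) \<in> parcs (delete_edge G (u, v))) \<and>
                   (y = q \<or> (y, q) \<in> parcs (delete_edge G (u, v)))"
          using z pq by (auto simp: parcs_subdivide_edge)
        then show ?thesis
          using P pq unfolding packing_def by blast
      qed
    qed
    show "card (Some ` P) = card (Some ` D)"
      using card by (simp add: card_image)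
  qed
  ultimately show ?thesis
    by (simp add: card_image)
qed

section \<open>Leaves and their neighbours\<close>

lemma leaf_neighbour_unique:
  assumes "leaf G v" "(v, x) \<in> parcs G" "(v, y) \<in> parcs G"
  shows "x = y"
proof -
  have "card (out_arcs (with_proj G) v) = 1"
    using assms(1) by (simp add: leaf_def out_degree_def)
  then obtain a where "out_arcs (with_proj G) v = {a}"
    by (rule card_1_singletonE)
  moreover have "(v, x) \<in> out_arcs (with_proj G) v" "(v, y) \<in> out_arcs (with_proj G) v"
    using assms(2,3) by (simp_all add: out_arcs_def)
  ultimately show ?thesis
    by auto
qed

text \<open>Used contrapositively: a non-leaf with a known neighbour has another one.\<close>

lemma unique_neighbour_leaf:
  assumes "v \<in> pverts G" "(v, x) \<in> parcs G" "\<And>y. (v, y) \<in> parcs G \<Longrightarrow> y = x"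
  shows "leaf G v"
proof -
  have "(v, y) \<in> parcs G \<longleftrightarrow> y = x" for y
    using assms(2) assms(3)[of y] by iprover
  then have "e \<in> out_arcs (with_proj G) v \<longleftrightarrow> e = (v, x)" for e
    by (cases e) (simp add: out_arcs_def, metis)
  then have "out_arcs (with_proj G) v = {(v, x)}"
    by blast
  then show ?thesis
    using assms(1) by (simp add: leaf_def out_degree_def)
qed

context pair_graph
begin

text \<open>Two adjacent leaves have only each other as neighbours, so no walk from \<open>a\<close>
  leaves \<open>{a, b}\<close>, and connectedness would leave at most two vertices.\<close>

lemma leaves_not_adjacent:
  assumes conn: "Digraph_Component.connected (with_proj G)" and card: "3 \<le> card (pverts G)"
    and leaves: "leaf G a" "leaf G b"
  shows "(a, b) \<notin> parcs G"
proof
  assume ab: "(a, b) \<in> parcs G"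
  then have ba: "(b, a) \<in> parcs G"
    by (rule arcs_symmetric)
  have "pverts G \<subseteq> {a, b}"
  proof
    fix c assume "c \<in> pverts G"
    moreover have "strongly_connected (with_proj G)"
      using conn pair_sym_arcs by (intro symmetric_connected_imp_strongly_connected)
    ultimately have "a \<rightarrow>\<^sup>*\<^bsub>with_proj G\<^esub> c"
      using leaves(1) by (simp add: strongly_connected_def leaf_def)
    then show "c \<in> {a, b}"
    proof (induct rule: reachable_induct)
      case base
      show ?case by simp
    next
      case (step x y)
      then have "(x, y) \<in> parcs G" by simp
      then show ?case
        using step leaf_neighbour_unique[OF leaves(1) ab, of y]
          leaf_neighbour_unique[OF leaves(2) ba, of y] by auto
    qed
  qed
  then have "card (pverts G) \<le> card {a, b}"
    by (intro card_mono) auto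
  also have "\<dots> \<le> 2"
    by (simp add: card_insert_if)
  finally show False
    using card by simp
qed

text \<open>Assuming that \<open>u\<close> is not a leaf costs no generality: two leaves are never
  adjacent, and both edge operations ignore orientation.\<close>

lemma hairy_domination_number_delete_eq_subdivide:
  assumes conn: "Digraph_Component.connected (with_proj G)" and card: "3 \<le> card (pverts G)"
    and hairy: "hairy_graph G" and e: "(u, v) \<in> parcs G" and u: "\<not> leaf G u"
  shows "domination_number (delete_edge G (u, v)) = domination_number (subdivide_edge G (u, v))"
proof -
  define S where "S = {x. support_vertex G x}"
  have nonadj: "(a, b) \<notin> parcs G" if "leaf G a" "leaf G b" for a b
    using leaves_not_adjacent[OF conn card that] .
  have S_verts: "S \<subseteq> pverts G"
    by (auto simp: S_def support_vertex_def)
  have finS: "finite S"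
    using S_verts pair_finite_verts by (rule finite_subset)
  \<comment> \<open>Hairiness puts each non-leaf in \<open>S\<close>; a leaf in \<open>S\<close>
    would be adjacent to a leaf. So \<open>S\<close> is exactly the complement of the
    leaves.\<close>
  have S_leaf: "x \<in> S \<longleftrightarrow> \<not> leaf G x" if "x \<in> pverts G" for x
    using that hairy nonadj by (auto simp: S_def hairy_graph_def support_vertex_def)
  have uV: "u \<in> pverts G" and vV: "v \<in> pverts G"
    using e by (auto intro: in_arcsD1 in_arcsD2)
  have uS: "u \<in> S"
    using S_leaf[OF uV] u by simp
  have e': "(v, u) \<in> parcs G" and "u \<noteq> v"
    using e arcs_symmetric no_loops' by blast+
  have dom_S: "\<exists>x\<in>S. (x, y) \<in> parcs G" if y: "leaf G y" for y
  proof -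
    have "card (out_arcs (with_proj G) y) = 1"
      using y by (simp add: leaf_def out_degree_def)
    then obtain a where "out_arcs (with_proj G) y = {a}"
      by (rule card_1_singletonE)
    then have "a \<in> parcs G" "fst a = y"
      by (auto simp: out_arcs_def)
    then have "(y, snd a) \<in> parcs G"
      by (cases a) simp
    then show ?thesis
      using S_leaf[of "snd a"] nonadj[of y "snd a"] y arcs_symmetric in_arcsD2 by blast
  qed
  \<comment> \<open>The choice at \<open>u\<close> avoids \<open>v\<close> whenever possible, so
    \<open>l u = v\<close> will mean that \<open>v\<close> is the only leaf at
    \<open>u\<close>.\<close>
  have "\<exists>y. leaf G y \<and> (x, y) \<in> parcs G \<and>
      (x = u \<and> (\<exists>v'. leaf G v' \<and> v' \<noteq> v \<and> (u, v') \<in> parcs G) \<longrightarrow> y \<noteq> v)" if "x \<in> S" for x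
    using that by (auto simp: S_def support_vertex_def)
  then obtain l where l: "\<And>x. x \<in> S \<Longrightarrow> leaf G (l x)" "\<And>x. x \<in> S \<Longrightarrow> (x, l x) \<in> parcs G"
      and l_u: "\<And>v'. leaf G v' \<Longrightarrow> v' \<noteq> v \<Longrightarrow> (u, v') \<in> parcs G \<Longrightarrow> l u \<noteq> v"
    using uS by metis
  have l_eq: "x = z" if "x \<in> S" "(z, l x) \<in> parcs G" for x z
    using leaf_neighbour_unique[OF l(1)] l(2) that arcs_symmetric by metis
  have inj: "inj_on l S"
    using l l_eq by (metis inj_onI)
  have leaf_V: "leaf G x \<Longrightarrow> x \<in> pverts G" for x
    by (simp add: leaf_def)
  \<comment> \<open>This supplies \<open>not_both\<close> for both packings used below, with and
    without \<open>v\<close>.\<close>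
  have u_P: "u \<notin> insert v (l ` S)"
    using u l(1) \<open>u \<noteq> v\<close> by auto
  \<comment> \<open>Deleting arcs only shrinks closed neighbourhoods, so disjointness is checked in
    \<open>G\<close>.\<close>
  have P: "packing (delete_edge G (u, v)) (l ` S)"
    unfolding packing_def
  proof (intro conjI ballI allI impI)
    show "l ` S \<subseteq> pverts (delete_edge G (u, v))"
      using l(1) leaf_V by (auto simp: delete_edge_def)
    fix p q z
    assume "p \<in> l ` S" "q \<in> l ` S"
      and "(z = p \<or> (z, p) \<in> parcs (delete_edge G (u, v))) \<and>
           (z = q \<or> (z, q) \<in> parcs (delete_edge G (u, v)))"
    then obtain x y where xy: "x \<in> S" "y \<in> S" "p = l x" "q = l y"
        and z: "z = l x \<or> (z, l x) \<in> parcs G" "z = l y \<or> (z, l y) \<in> parcs G"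
      by (auto simp: delete_edge_def)
    show "p = q"
      using z xy nonadj[OF l(1)[OF xy(1)] l(1)[OF xy(2)]] nonadj[OF l(1)[OF xy(2)] l(1)[OF xy(1)]]
        l_eq[OF xy(1), of z] l_eq[OF xy(2), of z] by auto
  qed
  show ?thesis
  proof (cases "leaf G v")
    case False
    \<comment> \<open>Neither end of the deleted edge is a leaf, so all arcs between leaves and
      \<open>S\<close> survive.\<close>
    have "dominating_set (delete_edge G (u, v)) S"
      unfolding dominating_set_def
    proof (intro conjI ballI)
      fix y assume "y \<in> pverts (delete_edge G (u, v)) - S"
      then have "leaf G y"
        using S_leaf by (auto simp: delete_edge_def)
      then show "\<exists>x\<in>S. x \<rightarrow>\<^bsub>with_proj (delete_edge G (u, v))\<^esub> y"
        using dom_S[of y] u False by (auto simp: delete_edge_def)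
    qed (use S_verts in \<open>simp add: delete_edge_def\<close>)
    then show ?thesis
      using uS u_P card_image[OF inj]
      by (intro domination_number_delete_eq_subdivide[OF pair_finite_verts _ _ P]) auto
  next
    case v: True
    have vS: "v \<notin> S"
      using S_leaf[OF vV] v by simp
    \<comment> \<open>The deleted edge was the only one at the leaf \<open>v\<close>.\<close>
    have v_isolated: "(z, v) \<notin> parcs (delete_edge G (u, v))" for z
      using leaf_neighbour_unique[OF v e', of z] arcs_symmetric by (auto simp: delete_edge_def)
    show ?thesis
    proof (cases "l u = v")
      case False
      \<comment> \<open>If \<open>v = l x\<close>, then the neighbour \<open>u\<close> of
        \<open>v\<close> must be \<open>x\<close>, contrary to
        \<open>l u \<noteq> v\<close>.\<close>
      have v_P: "v \<notin> l ` S"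
        using False l_eq e by auto
      have "dominating_set (delete_edge G (u, v)) (insert v S)"
        unfolding dominating_set_def
      proof (intro conjI ballI)
        fix y assume y: "y \<in> pverts (delete_edge G (u, v)) - insert v S"
        then have "leaf G y"
          using S_leaf by (auto simp: delete_edge_def)
        then show "\<exists>x\<in>insert v S. x \<rightarrow>\<^bsub>with_proj (delete_edge G (u, v))\<^esub> y"
          using dom_S[of y] u y by (auto simp: delete_edge_def)
      qed (use S_verts vV in \<open>simp add: delete_edge_def\<close>)
      moreover have P': "packing (delete_edge G (u, v)) (insert v (l ` S))"
      proof -
        have "(v, p) \<notin> parcs (delete_edge G (u, v))" if "p \<in> l ` S" for p
          using that l(1) nonadj[OF v] by (auto simp: delete_edge_def)
        then show ?thesis
          using P vV v_isolated unfolding packing_def by (auto simp: delete_edge_def)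
      qed
      moreover have "card (insert v (l ` S)) = card (insert v S)"
        using finS vS v_P card_image[OF inj] by simp
      ultimately show ?thesis
        using u_P by (intro domination_number_delete_eq_subdivide[OF pair_finite_verts _ _ P']) auto
    next
      case True
      \<comment> \<open>With \<open>u\<close> dropped from the dominating set, another vertex must
        dominate it. A second neighbour \<open>t\<close> is no leaf, as \<open>v\<close> is the only
        leaf at \<open>u\<close>, so \<open>t\<close> stays in the set.\<close>
      obtain t where t: "(u, t) \<in> parcs G" "t \<noteq> v"
        using unique_neighbour_leaf[OF uV e] u by blast
      then have tS: "t \<in> S - {u}"
        using l_u[of t] True S_leaf[of t] in_arcsD2 no_loops' by blast
      have "dominating_set (delete_edge G (u, v)) (insert v (S - {u}))"
        unfolding dominating_set_def
      proof (intro conjI ballI)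
        fix y assume y: "y \<in> pverts (delete_edge G (u, v)) - insert v (S - {u})"
        show "\<exists>x\<in>insert v (S - {u}). x \<rightarrow>\<^bsub>with_proj (delete_edge G (u, v))\<^esub> y"
        proof (cases "y = u")
          case True
          then show ?thesis
            using tS t arcs_symmetric[OF t(1)] by (auto simp: delete_edge_def)
        next
          case False
          then have yl: "leaf G y"
            using y S_leaf by (auto simp: delete_edge_def)
          then obtain x where x: "x \<in> S" "(x, y) \<in> parcs G"
            using dom_S by blast
          \<comment> \<open>Otherwise \<open>y\<close> would be a leaf at \<open>u\<close> other
            than \<open>v\<close>.\<close>
          have "x \<noteq> u"
            using l_u[OF yl] x(2) y True by auto
          then show ?thesis
            using x y False by (auto simp: delete_edge_def)
        qed
      qed (use S_verts vV in \<open>auto simp: delete_edge_def\<close>)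
      moreover have "card (l ` S) = card (insert v (S - {u}))"
        using finS vS uS card_image[OF inj] card_Suc_Diff1[OF finS uS] by simp
      ultimately show ?thesis
        using u_P by (intro domination_number_delete_eq_subdivide[OF pair_finite_verts _ _ P]) auto
    qed
  qed
qed

end

theorem theorem5:
  fixes G :: "'a pair_pre_digraph"
  assumes "pair_graph G"
    and "Digraph_Component.connected (with_proj G)"
    and "3 \<le> card (pverts G)"
    and "hairy_graph G"
  shows "sr_graph G"
proof -
  interpret pair_graph G by fact
  have "domination_number (delete_edge G (u, v)) = domination_number (subdivide_edge G (u, v))"
    if e: "(u, v) \<in> parcs G" for u v
  proof (cases "leaf G u")
    case False
    then show ?thesis
      using hairy_domination_number_delete_eq_subdivide[OF assms(2-4) e] by simp
  next
    case True
    then have "\<not> leaf G v"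
      using leaves_not_adjacent[OF assms(2,3)] e by blast
    then show ?thesis
      using hairy_domination_number_delete_eq_subdivide[OF assms(2-4) arcs_symmetric[OF e]]
      by (simp add: delete_edge_commute[of G u v] subdivide_edge_commute[of G u v])
  qed
  then show ?thesis
    using assms unfolding sr_graph_def by auto
qed

end
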